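(* Let $c_1=e^{e^e}$. There exist constants $c_2>0$ and $c>0$ such that the following holds. Let $p=p(n)$ satisfy $c_1/n\le p\le 1-c_2\frac{\log n}{n^2}$, and let $G\in\mathcal{G}(n,p)$. Then, with probability tending to $1$ as $n\to\infty$, $\mathrm{box}(G)\ge c\,np(1-p)$; that is, almost surely $\mathrm{box}(G)=\Omega(np(1-p))$.
   Context: $\mathcal{G}(n,p)$ is the random graph on $n$ labelled vertices in which each of the $\binom{n}{2}$ possible edges is present independently with probability $p$. The boxicity $\mathrm{box}(G)$ is the minimum $k$ such that there are interval graphs $I_1,\dots,I_k$ on $V(G)$ with $E(G)=E(I_1)\cap\cdots\cap E(I_k)$. $\log$ is the natural logarithm. *)

theory Defs
  imports "HOL-Probability.Probability"
begin

text \<open>A simple graph on a vertex set \<open>V\<close> is given by its edge set \<open>E \<subseteq> pairs V\<close>.\<close>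

definition pairs :: "'a set \<Rightarrow> 'a set set" where
  "pairs V = {e. e \<subseteq> V \<and> card e = 2}"

lemma finite_pairs: "finite V \<Longrightarrow> finite (pairs V)"
  unfolding pairs_def by (rule finite_subset[of _ "Pow V"]) auto

lemma doubleton_in_pairs: "{u, v} \<in> pairs V \<longleftrightarrow> u \<in> V \<and> v \<in> V \<and> u \<noteq> v"
  by (cases "u = v") (simp_all add: pairs_def)

definition interval_graph :: "'a set \<Rightarrow> 'a set set \<Rightarrow> bool" where
  "interval_graph V E \<longleftrightarrow>
     E \<subseteq> pairs V \<and>
     (\<exists>l r :: 'a \<Rightarrow> real.
        (\<forall>v\<in>V. l v \<le> r v) \<and>
        (\<forall>u\<in>V. \<forall>v\<in>V. u \<noteq> v \<longrightarrow>
           ({u, v} \<in> E \<longleftrightarrow> {l u..r u} \<inter> {l v..r v} \<noteq> {})))"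

definition interval_representable :: "'a set \<Rightarrow> 'a set set \<Rightarrow> nat \<Rightarrow> bool" where
  "interval_representable V E k \<longleftrightarrow>
     (\<exists>I :: nat \<Rightarrow> 'a set set.
        (\<forall>i<k. interval_graph V (I i)) \<and> E = {e \<in> pairs V. \<forall>i<k. e \<in> I i})"

text \<open>
  The intersection of no graphs on \<open>V\<close> is the complete graph, so complete graphs have
  boxicity \<open>0\<close>, as is usual.
\<close>

definition boxicity :: "'a set \<Rightarrow> 'a set set \<Rightarrow> nat" where
  "boxicity V E = (LEAST k. interval_representable V E k)"

text \<open>
  On a finite vertex set the minimum is attained: intersect the graphs that miss exactly one
  pair, over all non-edges.
\<close>

lemma interval_graph_remove_edge:
  assumes "e \<in> pairs V"
  shows "interval_graph V (pairs V - {e})"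
proof -
  obtain a b where ab: "e = {a, b}" "a \<noteq> b" "a \<in> V" "b \<in> V"
    using assms by (auto simp: pairs_def card_2_iff)
  define l :: "'a \<Rightarrow> real" where "l v = (if v = b then 1 else 0)" for v
  define r :: "'a \<Rightarrow> real" where "r v = (if v = a then 0 else 1)" for v
  have "{u, v} \<in> pairs V - {e} \<longleftrightarrow> {l u..r u} \<inter> {l v..r v} \<noteq> {}"
    if "u \<in> V" "v \<in> V" "u \<noteq> v" for u v
  proof -
    have "{u, v} \<in> pairs V - {e} \<longleftrightarrow> \<not> (u = a \<and> v = b) \<and> \<not> (u = b \<and> v = a)"
      using that ab(1) by (simp add: doubleton_eq_iff doubleton_in_pairs)
    also have "\<dots> \<longleftrightarrow> max (l u) (l v) \<le> min (r u) (r v)"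
      using that ab(2) by (auto simp: l_def r_def)
    also have "\<dots> \<longleftrightarrow> {l u..r u} \<inter> {l v..r v} \<noteq> {}"
      by auto
    finally show ?thesis .
  qed
  moreover have "l v \<le> r v" for v
    using ab by (auto simp: l_def r_def)
  ultimately show ?thesis
    unfolding interval_graph_def by (intro conjI exI[of _ l] exI[of _ r] ballI impI) simp_all
qed

lemma interval_representable_boxicity:
  assumes "finite V" "E \<subseteq> pairs V"
  shows "interval_representable V E (boxicity V E)"
proof -
  have "finite (pairs V - E)"
    using assms(1) by (simp add: finite_pairs)
  from finite_imp_nat_seg_image_inj_on[OF this] obtain f and k :: nat
    where f: "pairs V - E = f ` {i. i < k}"
    by (elim exE conjE)
  have "interval_graph V (pairs V - {f i})" if "i < k" for i
  proof -
    have "f i \<in> pairs V - E"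
      unfolding f using that by simp
    then show ?thesis
      by (simp add: interval_graph_remove_edge)
  qed
  moreover have "E = {e \<in> pairs V. \<forall>i<k. e \<in> pairs V - {f i}}"
  proof -
    have "e \<in> E \<longleftrightarrow> (\<forall>i<k. e \<noteq> f i)" if "e \<in> pairs V" for e
    proof -
      have "e \<notin> E \<longleftrightarrow> e \<in> f ` {i. i < k}"
        using that unfolding f[symmetric] by simp
      then show ?thesis
        by auto
    qed
    with assms(2) show ?thesis
      by auto
  qed
  ultimately have "interval_representable V E k"
    unfolding interval_representable_def
    by (intro exI[of _ "\<lambda>i. pairs V - {f i}"] conjI allI impI)
  then show ?thesis
    unfolding boxicity_def by (rule LeastI)
qed

text \<open>The random graph on the vertex set \<open>{..<n}\<close>, as a distribution on edge sets.\<close>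

definition random_graph :: "nat \<Rightarrow> real \<Rightarrow> nat set set pmf" where
  "random_graph n p =
     map_pmf (\<lambda>\<omega>. {e \<in> pairs {..<n}. \<omega> e})
       (Pi_pmf (pairs {..<n}) False (\<lambda>_. bernoulli_pmf p))"

end

theory Submission
  imports Defs "HOL-Real_Asymp.Real_Asymp"
begin

text \<open>
  In an interval supergraph of \<open>G\<close>, the vertices lying entirely to the right of \<open>u\<close> have no
  \<open>G\<close>-neighbour among the vertices whose right endpoint is at most that of \<open>u\<close>. So if every
  \<open>i\<close> vertices of \<open>G\<close> have at most \<open>f i\<close> common non-neighbours, sorting by right endpoints
  shows that an interval supergraph omits at most \<open>f 1 + \<dots> + f n\<close> pairs, and the boxicity is
  at least the number of non-edges of \<open>G\<close> divided by this sum. In the random graph, a union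
  bound over pairs of vertex sets of sizes \<open>i\<close> and \<open>t\<close> allows
  \<open>f i = (6 / p) ln (e n / i) + e n exp (- p i / 6)\<close>, whose sum is only \<open>O(n / p)\<close>, without
  a logarithmic loss. The number of non-edges is of order \<open>n\<^sup>2 (1 - p)\<close> with high probability.
\<close>

section \<open>Counting the pairs omitted by an interval supergraph\<close>

text \<open>With distinct values of \<open>r\<close> the cardinalities are exactly
  \<open>1, ..., card V\<close>, giving equality. Ties only enlarge them, and \<open>f\<close> is
  decreasing.\<close>

lemma sum_antimono_card_le:
  fixes r :: "'a \<Rightarrow> 'b::linorder" and f :: "nat \<Rightarrow> real"
  assumes "finite V" "\<And>i j. 1 \<le> i \<Longrightarrow> i \<le> j \<Longrightarrow> j \<le> card V \<Longrightarrow> f j \<le> f i"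
  shows "(\<Sum>u\<in>V. f (card {w\<in>V. r w \<le> r u})) \<le> (\<Sum>i=1..card V. f i)"
  using assms
proof (induction V rule: finite_ranking_induct[where f = r])
  case empty
  then show ?case by simp
next
  case (insert x S)
  show ?case
  proof (cases "x \<in> S")
    case True
    with insert show ?thesis by (simp add: insert_absorb)
  next
    case False
    \<comment> \<open>The induction adds an element \<open>x\<close> of maximal \<open>r\<close>. It
      enters the set counted for \<open>u\<close> only if \<open>r x = r u\<close>, and its own set
      is everything.\<close>
    have "f (card {w \<in> insert x S. r w \<le> r u}) \<le> f (card {w\<in>S. r w \<le> r u})" if "u \<in> S" for u
    proof (rule insert.prems)
      show "1 \<le> card {w \<in> S. r w \<le> r u}"
        using that insert.hyps(1) by (auto simp: Suc_le_eq card_gt_0_iff)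
      show "card {w \<in> S. r w \<le> r u} \<le> card {w \<in> insert x S. r w \<le> r u}"
        using insert.hyps(1) by (intro card_mono) auto
      show "card {w \<in> insert x S. r w \<le> r u} \<le> card (insert x S)"
        using insert.hyps(1) by (intro card_mono) auto
    qed
    then have "(\<Sum>u\<in>S. f (card {w \<in> insert x S. r w \<le> r u})) \<le> (\<Sum>u\<in>S. f (card {w\<in>S. r w \<le> r u}))"
      by (rule sum_mono)
    also have "\<dots> \<le> (\<Sum>i=1..card S. f i)"
    proof (rule insert.IH)
      fix i j :: nat
      assume "1 \<le> i" "i \<le> j" "j \<le> card S"
      then show "f j \<le> f i"
        using insert.prems[of i j] insert.hyps(1) False by simp
    qed
    finally have "(\<Sum>u\<in>S. f (card {w \<in> insert x S. r w \<le> r u})) \<le> (\<Sum>i=1..card S. f i)" .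
    moreover have "{w \<in> insert x S. r w \<le> r x} = insert x S"
      using insert.hyps by auto
    ultimately show ?thesis
      using insert.hyps(1) False by simp
  qed
qed

text \<open>Each omitted pair is charged to the vertex \<open>u\<close> whose interval ends first;
  its partner then starts after \<open>r u\<close>. The vertices ending no later than
  \<open>u\<close> and those starting after \<open>r u\<close> form a non-adjacent pair of sets, to
  which \<open>nonadj\<close> applies.\<close>

lemma interval_graph_card_nonedges_le:
  fixes f :: "nat \<Rightarrow> real"
  assumes "finite V" "interval_graph V I"
    and antimono: "\<And>i j. 1 \<le> i \<Longrightarrow> i \<le> j \<Longrightarrow> j \<le> card V \<Longrightarrow> f j \<le> f i"
    and nonadj: "\<And>S T. S \<subseteq> V \<Longrightarrow> T \<subseteq> V \<Longrightarrow> S \<inter> T = {} \<Longrightarrow> S \<noteq> {} \<Longrightarrow>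
      (\<forall>s\<in>S. \<forall>t\<in>T. {s, t} \<notin> I) \<Longrightarrow> real (card T) \<le> f (card S)"
  shows "real (card (pairs V - I)) \<le> (\<Sum>i=1..card V. f i)"
proof -
  from assms(2) obtain l r :: "'a \<Rightarrow> real" where
    lr: "\<And>v. v \<in> V \<Longrightarrow> l v \<le> r v" and
    adj: "\<And>u v. u \<in> V \<Longrightarrow> v \<in> V \<Longrightarrow> u \<noteq> v \<Longrightarrow>
      ({u, v} \<in> I \<longleftrightarrow> {l u..r u} \<inter> {l v..r v} \<noteq> {})"
    unfolding interval_graph_def by metis
  define A where "A u = {v\<in>V. r u < l v}" for u
  have fin: "finite (A u)" for u
    using assms(1) by (simp add: A_def)
  have "pairs V - I \<subseteq> (\<lambda>(u, v). {u, v}) ` (SIGMA u:V. A u)"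
  proof
    fix e
    assume "e \<in> pairs V - I"
    then obtain u v where e: "e = {u, v}" "u \<noteq> v" "u \<in> V" "v \<in> V" "{u, v} \<notin> I"
      by (auto simp: pairs_def card_2_iff)
    with adj have "{l u..r u} \<inter> {l v..r v} = {}" by blast
    \<comment> \<open>The larger left endpoint would be a common point unless it lies beyond one of
      the right endpoints.\<close>
    then have "max (l u) (l v) \<notin> {l u..r u} \<inter> {l v..r v}" by blast
    with lr[of u] lr[of v] e have "r u < l v \<or> r v < l u" by auto
    then have "(u, v) \<in> (SIGMA u:V. A u) \<or> (v, u) \<in> (SIGMA u:V. A u)"
      using e by (auto simp: A_def)
    then show "e \<in> (\<lambda>(u, v). {u, v}) ` (SIGMA u:V. A u)"
      using e(1) by (force simp: image_iff insert_commute)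
  qed
  then have "card (pairs V - I) \<le> card (SIGMA u:V. A u)"
    using assms(1) fin by (intro surj_card_le) auto
  also have "\<dots> = (\<Sum>u\<in>V. card (A u))"
    using assms(1) fin by simp
  finally have "real (card (pairs V - I)) \<le> (\<Sum>u\<in>V. real (card (A u)))"
    by (metis of_nat_le_iff of_nat_sum)
  also have "\<dots> \<le> (\<Sum>u\<in>V. f (card {w\<in>V. r w \<le> r u}))"
  proof (intro sum_mono nonadj)
    fix u
    assume u: "u \<in> V"
    have less: "r s < l t" "s \<in> V" "t \<in> V" "s \<noteq> t" if "s \<in> {w\<in>V. r w \<le> r u}" "t \<in> A u" for s t
      using that lr[of s] by (auto simp: A_def)
    show "{w\<in>V. r w \<le> r u} \<inter> A u = {}"
      using less by blast
    show "\<forall>s\<in>{w\<in>V. r w \<le> r u}. \<forall>t\<in>A u. {s, t} \<notin> I"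
    proof (intro ballI)
      fix s t
      assume "s \<in> {w\<in>V. r w \<le> r u}" "t \<in> A u"
      from less[OF this] show "{s, t} \<notin> I"
        by (subst adj) auto
    qed
  qed (auto simp: A_def)
  also have "\<dots> \<le> (\<Sum>i=1..card V. f i)"
    using assms(1) antimono by (rule sum_antimono_card_le)
  finally show ?thesis .
qed

text \<open>Every non-edge is omitted by one of the \<open>k\<close> interval graphs. Each of these
  contains \<open>E\<close>, so sets non-adjacent in it are non-adjacent in \<open>E\<close>, and
  the hypothesis on \<open>E\<close> transfers.\<close>

lemma card_nonedges_le_boxicity_mult:
  fixes f :: "nat \<Rightarrow> real"
  assumes "finite V" "E \<subseteq> pairs V"
    and antimono: "\<And>i j. 1 \<le> i \<Longrightarrow> i \<le> j \<Longrightarrow> j \<le> card V \<Longrightarrow> f j \<le> f i"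
    and nonadj: "\<And>S T. S \<subseteq> V \<Longrightarrow> T \<subseteq> V \<Longrightarrow> S \<inter> T = {} \<Longrightarrow> S \<noteq> {} \<Longrightarrow>
      (\<forall>s\<in>S. \<forall>t\<in>T. {s, t} \<notin> E) \<Longrightarrow> real (card T) \<le> f (card S)"
  shows "real (card (pairs V - E)) \<le> real (boxicity V E) * (\<Sum>i=1..card V. f i)"
proof -
  define k where "k = boxicity V E"
  from interval_representable_boxicity[OF assms(1,2)] obtain I where
    I: "\<And>i. i < k \<Longrightarrow> interval_graph V (I i)" and E: "E = {e \<in> pairs V. \<forall>i<k. e \<in> I i}"
    unfolding interval_representable_def k_def by blast
  have "pairs V - E = (\<Union>i<k. pairs V - I i)"
    unfolding E by auto
  then have "card (pairs V - E) \<le> (\<Sum>i<k. card (pairs V - I i))"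
    by (simp only: card_UN_le finite_lessThan)
  then have "real (card (pairs V - E)) \<le> (\<Sum>i<k. real (card (pairs V - I i)))"
    by (metis of_nat_le_iff of_nat_sum)
  also have "\<dots> \<le> (\<Sum>i<k. \<Sum>j=1..card V. f j)"
  proof (intro sum_mono interval_graph_card_nonedges_le assms(1) I antimono nonadj)
    fix i S T
    assume "i \<in> {..<k}" "\<forall>s\<in>S. \<forall>t\<in>T. {s, t} \<notin> I i"
    then show "\<forall>s\<in>S. \<forall>t\<in>T. {s, t} \<notin> E"
      by (auto simp: E)
  qed auto
  finally show ?thesis
    by (simp add: k_def)
qed

section \<open>The sum of the bounds on common non-neighbourhoods\<close>

text \<open>The left side divided by \<open>fact n\<close> is a single term of the exponential
  series at \<open>n\<close>.\<close>

lemma power_self_le_exp_fact: "real n ^ n \<le> exp (real n) * fact n"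
proof -
  have "(\<Sum>i\<in>{n}. real n ^ i /\<^sub>R fact i) \<le> exp (real n)"
    unfolding exp_def by (intro sum_le_suminf summable_exp_generic) auto
  then show ?thesis
    by (simp add: field_simps)
qed

text \<open>The logarithms add up to that of \<open>n ^ n / fact n\<close>, which is at most
  \<open>n\<close>. Bounding them one by one by \<open>ln n\<close> would cost a logarithmic
  factor.\<close>

lemma sum_ln_ratio_le: "(\<Sum>i=1..n. 1 + ln (real n / real i)) \<le> 2 * real n"
proof (cases "n = 0")
  case False
  have "(\<Sum>i=1..n. ln (real n / real i)) = ln (\<Prod>i=1..n. real n / real i)"
    using False by (subst ln_prod) auto
  also have "(\<Prod>i=1..n. real n / real i) = real n ^ n / fact n"
    by (simp add: prod_dividef fact_prod)
  also have "ln \<dots> \<le> ln (exp (real n))"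
    using False power_self_le_exp_fact[of n] by (subst ln_le_cancel_iff) (auto simp: field_simps)
  finally show ?thesis
    by (simp add: sum.distrib)
qed simp

lemma sum_exp_neg_le:
  fixes a :: real
  assumes "a > 0"
  shows "(\<Sum>i=1..n. exp (- (a * real i))) \<le> 1 / a"
proof -
  \<comment> \<open>The subtracted term makes the induction telescope: by
    \<open>1 + a \<le> exp a\<close>, each summand times \<open>a\<close> is at most the drop of
    \<open>exp (- (a * n))\<close> from one index to the next.\<close>
  have *: "(\<Sum>i=1..n. exp (- (a * real i))) * a \<le> 1 - exp (- (a * real n))"
  proof (induction n)
    case (Suc n)
    have "1 + a \<le> exp a" by simp
    then have "exp (- (a * real (Suc n))) * (1 + a) \<le> exp (- (a * real (Suc n))) * exp a"
      by (intro mult_left_mono) auto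
    also have "\<dots> = exp (- (a * real n))"
      by (simp add: exp_add[symmetric] algebra_simps)
    finally show ?case using Suc by (simp add: algebra_simps)
  qed simp
  also have "\<dots> \<le> 1" by simp
  finally show ?thesis using assms by (simp add: field_simps)
qed

text \<open>A union bound over sets of sizes \<open>i\<close> and \<open>t\<close> succeeds unless
  \<open>p * t\<close> is below \<open>6 * (1 + ln (n / i))\<close> or \<open>p * i\<close> is below
  \<open>6 * (1 + ln (n / t))\<close>. The summands are these two conditions solved for
  \<open>t\<close>.\<close>

definition nonnbr_bound :: "nat \<Rightarrow> real \<Rightarrow> nat \<Rightarrow> real" where
  "nonnbr_bound n p i =
     6 / p * (1 + ln (real n / real i)) + exp 1 * real n * exp (- (p / 6 * real i))"

lemma nonnbr_bound_antimono:
  assumes "p > 0" "1 \<le> i" "i \<le> j" "j \<le> n"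
  shows "nonnbr_bound n p j \<le> nonnbr_bound n p i"
proof -
  have "ln (real n / real j) \<le> ln (real n / real i)"
    using assms by (subst ln_le_cancel_iff) (auto simp: field_simps)
  then show ?thesis
    unfolding nonnbr_bound_def using assms by (intro add_mono mult_left_mono) auto
qed

text \<open>The logarithmic summands contribute \<open>12 * n / p\<close>. The exponential ones
  contribute at most \<open>18 * n / p\<close>, using \<open>exp 1 \<le> 3\<close>.\<close>

lemma sum_nonnbr_bound_le:
  assumes "p > 0"
  shows "(\<Sum>i=1..n. nonnbr_bound n p i) \<le> 30 * real n / p"
proof -
  have "(\<Sum>i=1..n. nonnbr_bound n p i) =
      6 / p * (\<Sum>i=1..n. 1 + ln (real n / real i)) +
      exp 1 * real n * (\<Sum>i=1..n. exp (- (p / 6 * real i)))"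
    unfolding nonnbr_bound_def by (simp only: sum.distrib[of "\<lambda>i. 6 / p * _ i"] sum_distrib_left)
  also have "\<dots> \<le> 6 / p * (2 * real n) + exp 1 * real n * (1 / (p / 6))"
    using assms by (intro add_mono mult_left_mono sum_ln_ratio_le sum_exp_neg_le) auto
  also have "\<dots> \<le> 6 / p * (2 * real n) + 3 * real n * (1 / (p / 6))"
    using assms exp_le by (intro add_mono mult_left_mono mult_right_mono) auto
  also have "\<dots> = 30 * real n / p"
    by (simp add: field_simps)
  finally show ?thesis .
qed

lemma le_nonnbr_bound:
  assumes "p > 0" "1 \<le> i" "i \<le> n" "1 \<le> t" "t \<le> n"
    and "p * real t < 6 * (1 + ln (real n / real i)) \<or> p * real i < 6 * (1 + ln (real n / real t))"
  shows "real t \<le> nonnbr_bound n p i"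
proof -
  have "ln (real n / real i) \<ge> 0"
    using assms by (intro ln_ge_zero) auto
  then have nonneg: "6 / p * (1 + ln (real n / real i)) \<ge> 0"
    using assms(1) by (intro mult_nonneg_nonneg) auto
  from assms(6) show ?thesis
  proof
    assume "p * real t < 6 * (1 + ln (real n / real i))"
    then have "real t \<le> 6 / p * (1 + ln (real n / real i))"
      using assms(1) by (simp add: field_simps)
    moreover have "exp 1 * real n * exp (- (p / 6 * real i)) \<ge> 0"
      by simp
    ultimately show ?thesis
      unfolding nonnbr_bound_def by linarith
  next
    assume "p * real i < 6 * (1 + ln (real n / real t))"
    then have "exp (p / 6 * real i) \<le> exp (1 + ln (real n / real t))"
      by simp
    also have "\<dots> = exp 1 * (real n / real t)"
      using assms by (subst exp_add) simp
    finally have "real t \<le> exp 1 * real n * exp (- (p / 6 * real i))"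
      using assms by (simp add: field_simps exp_minus)
    with nonneg show ?thesis
      unfolding nonnbr_bound_def by linarith
  qed
qed

section \<open>Non-adjacent pairs of vertex sets in the random graph\<close>

text \<open>This is the standard bound \<open>(e * n / i) ^ i\<close>, obtained from a single term
  in the binomial expansion of \<open>(1 + i / n) ^ n\<close>, which is at most
  \<open>exp i\<close>.\<close>

lemma binomial_le_exp_ln:
  assumes "1 \<le> i" "i \<le> n"
  shows "real (n choose i) \<le> exp (real i * (1 + ln (real n / real i)))"
proof -
  have pos: "real n > 0" "real i > 0" using assms by auto
  have "real (n choose i) * (real i / real n) ^ i \<le> (\<Sum>k\<le>n. real (n choose k) * (real i / real n) ^ k)"
    using assms by (intro member_le_sum) auto
  also have "\<dots> = (1 + real i / real n) ^ n"
    using binomial_ring[of "real i / real n" 1 n] by (simp add: add.commute)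
  also have "\<dots> \<le> exp (real i / real n) ^ n"
    by (intro power_mono) auto
  also have "\<dots> = exp (real i)"
    using pos by (simp add: exp_of_nat_mult[symmetric])
  finally have "real (n choose i) \<le> exp (real i) * (real n / real i) ^ i"
    using pos by (simp add: field_simps power_divide)
  also have "(real n / real i) ^ i = exp (real i * ln (real n / real i))"
    using pos by (subst exp_of_nat_mult) simp
  finally show ?thesis
    by (simp add: exp_add[symmetric] algebra_simps)
qed

text \<open>The left side is the value of the right side at \<open>i = 1\<close>. The difference of
  the two is \<open>(i - 1 - ln i) + (i - 1) * (ln n - ln i)\<close>, with both parts
  nonnegative.\<close>

lemma mult_ln_ratio_ge:
  assumes "1 \<le> i" "i \<le> n"
  shows "1 + ln (real n) \<le> real i * (1 + ln (real n / real i))"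
proof -
  have pos: "real n > 0" "real i > 0" using assms by auto
  have "ln (real i) \<le> real i - 1"
    using pos by (intro ln_le_minus_one) auto
  moreover have "(real i - 1) * ln (real i) \<le> (real i - 1) * ln (real n)"
    using assms by (intro mult_left_mono) auto
  moreover have L: "ln (real n / real i) = ln (real n) - ln (real i)"
    using pos by (simp add: ln_div)
  ultimately show ?thesis
    unfolding L by (simp add: algebra_simps)
qed

text \<open>Of the factor 3 in the exponent, one unit pays for the number of sets of a given size.
  The other two leave at most \<open>1 / n^2\<close> for each of the \<open>n\<close> sizes.\<close>

lemma sum_exp_neg_ln_ratio_le:
  assumes "n \<ge> 1"
  shows "(\<Sum>S\<in>Pow {..<n} - {{}}.
    exp (- 3 * (real (card S) * (1 + ln (real n / real (card S)))))) \<le> 1 / real n"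
proof -
  define L where "L i = real i * (1 + ln (real n / real i))" for i
  have "(\<Sum>S\<in>Pow {..<n} - {{}}. exp (- 3 * L (card S))) =
      (\<Sum>i=1..n. \<Sum>S | S \<in> Pow {..<n} - {{}} \<and> card S = i. exp (- 3 * L (card S)))"
  proof (rule sum.group[symmetric])
    show "card ` (Pow {..<n} - {{}}) \<subseteq> {1..n}"
    proof (rule image_subsetI)
      fix S
      assume "S \<in> Pow {..<n} - {{}}"
      then show "card S \<in> {1..n}"
        using card_mono[of "{..<n}" S] finite_subset[of S "{..<n}"]
        by (auto simp: Suc_le_eq card_gt_0_iff)
    qed
  qed auto
  also have "\<dots> = (\<Sum>i=1..n. real (n choose i) * exp (- 3 * L i))"
  proof (rule sum.cong[OF refl])
    fix i
    assume "i \<in> {1..n}"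
    then have "{S. S \<in> Pow {..<n} - {{}} \<and> card S = i} = {S. S \<subseteq> {..<n} \<and> card S = i}"
      by auto
    then show "(\<Sum>S | S \<in> Pow {..<n} - {{}} \<and> card S = i. exp (- 3 * L (card S))) =
        real (n choose i) * exp (- 3 * L i)"
      by (simp add: n_subsets)
  qed
  also have "\<dots> \<le> (\<Sum>i=1..n. exp (- 2 * ln (real n)))"
  proof (rule sum_mono)
    fix i
    assume "i \<in> {1..n}"
    then have i: "1 \<le> i" "i \<le> n" by auto
    have "real (n choose i) * exp (- 3 * L i) \<le> exp (L i) * exp (- 3 * L i)"
      using binomial_le_exp_ln[OF i] by (intro mult_right_mono) (auto simp: L_def)
    also have "\<dots> = exp (- 2 * L i)"
      by (simp add: exp_add[symmetric])
    also have "\<dots> \<le> exp (- 2 * ln (real n))"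
      using mult_ln_ratio_ge[OF i] by (simp add: L_def)
    finally show "real (n choose i) * exp (- 3 * L i) \<le> exp (- 2 * ln (real n))" .
  qed
  also have "exp (- 2 * ln (real n)) = inverse (real n ^ 2)"
    using assms by (simp add: exp_minus exp_of_nat_mult[of 2, simplified])
  also have "(\<Sum>i=1..n. inverse (real n ^ 2)) = 1 / real n"
    by (simp add: power2_eq_square field_simps)
  finally show ?thesis
    by (simp add: L_def)
qed

section \<open>Tail bounds for independent Bernoulli trials\<close>

lemma prob_Pi_bernoulli_all_False_le:
  assumes "finite A" "F \<subseteq> A" "0 \<le> p" "p \<le> 1"
  shows "measure_pmf.prob (Pi_pmf A d (\<lambda>_. bernoulli_pmf p)) {\<omega>. \<forall>e\<in>F. \<not> \<omega> e}
    \<le> exp (- (p * real (card F)))"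
proof -
  have "{\<omega>. \<forall>e\<in>F. \<not> \<omega> e} = Pi A (\<lambda>e. if e \<in> F then {False} else UNIV)"
    using assms(2) by (auto simp: Pi_def)
  then have "measure_pmf.prob (Pi_pmf A d (\<lambda>_. bernoulli_pmf p)) {\<omega>. \<forall>e\<in>F. \<not> \<omega> e} =
      (\<Prod>e\<in>A. measure_pmf.prob (bernoulli_pmf p) (if e \<in> F then {False} else UNIV))"
    using assms(1) by (simp add: measure_Pi_pmf_Pi)
  also have "\<dots> = (\<Prod>e\<in>A. if e \<in> F then 1 - p else 1)"
    using assms(3,4) by (intro prod.cong) (auto simp: measure_pmf_single)
  also have "\<dots> = (1 - p) ^ card F"
    using assms(1,2) by (simp add: prod.If_cases Int_absorb1)
  also have "\<dots> \<le> exp (- p) ^ card F"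
    using assms(4) exp_ge_add_one_self[of "- p"] by (intro power_mono) auto
  also have "\<dots> = exp (- (p * real (card F)))"
    by (simp add: exp_of_nat_mult[symmetric] mult.commute)
  finally show ?thesis .
qed

text \<open>Markov's inequality for \<open>2 powr - X\<close>, where \<open>X\<close> counts the failures.\<close>

lemma prob_few_False_le:
  assumes "finite A" "0 \<le> p" "p \<le> 1"
  shows "measure_pmf.prob (Pi_pmf A d (\<lambda>_. bernoulli_pmf p))
      {\<omega>. real (card {e\<in>A. \<not> \<omega> e}) \<le> real (card A) * (1 - p) / 4}
    \<le> exp (- (real (card A) * (1 - p) / 4))"
proof -
  \<comment> \<open>A quarter of the expected number of failures. The expectation below is at most
    \<open>exp (- (2 * a))\<close> and the Markov level is \<open>exp (- a)\<close>, so
    \<open>exp (- a)\<close> remains.\<close>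
  define a where "a = real (card A) * (1 - p) / 4"
  define g :: "bool \<Rightarrow> real" where "g b = (if b then 1 else 1 / 2)" for b
  let ?M = "Pi_pmf A d (\<lambda>_. bernoulli_pmf p)"
  have a0: "a \<ge> 0" using assms by (simp add: a_def)
  have g: "(\<Prod>e\<in>A. g (\<omega> e)) = (1 / 2) ^ card {e\<in>A. \<not> \<omega> e}" for \<omega>
    using assms(1) unfolding g_def
    by (simp add: prod.If_cases Collect_neg_eq[symmetric] Int_def)
  have "measure_pmf.expectation ?M (\<lambda>\<omega>. \<Prod>e\<in>A. g (\<omega> e)) =
      (\<Prod>e\<in>A. measure_pmf.expectation (bernoulli_pmf p) g)"
    using assms(1)
    by (intro expectation_prod_Pi_pmf) (auto simp: g_def intro!: integrable_measure_pmf_finite)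
  also have "\<dots> = (1 - (1 - p) / 2) ^ card A"
    using assms by (simp add: g_def field_simps)
  also have "\<dots> \<le> exp (- ((1 - p) / 2)) ^ card A"
    using assms exp_ge_add_one_self[of "- ((1 - p) / 2)"]
    by (intro power_mono) (auto simp: field_simps)
  also have "\<dots> = exp (- (2 * a))"
    by (simp add: exp_of_nat_mult[symmetric] a_def field_simps)
  finally have E: "measure_pmf.expectation ?M (\<lambda>\<omega>. \<Prod>e\<in>A. g (\<omega> e)) \<le> exp (- (2 * a))" .
  have sub: "{\<omega>. real (card {e\<in>A. \<not> \<omega> e}) \<le> a} \<subseteq> {\<omega>. exp (- a) \<le> (\<Prod>e\<in>A. g (\<omega> e))}"
  proof clarify
    fix \<omega> :: "'a \<Rightarrow> bool"
    let ?k = "card {e\<in>A. \<not> \<omega> e}"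
    assume "real ?k \<le> a"
    then have "exp (- a) \<le> exp (- real ?k)" by simp
    also have "\<dots> = exp (- 1) ^ ?k"
      by (simp add: exp_of_nat_mult[symmetric])
    \<comment> \<open>Uses \<open>exp 1 \<ge> 2\<close>.\<close>
    also have "\<dots> \<le> (1 / 2) ^ ?k"
      using exp_ge_add_one_self[of 1] by (intro power_mono) (auto simp: exp_minus field_simps)
    finally show "exp (- a) \<le> (\<Prod>e\<in>A. g (\<omega> e))"
      by (simp only: g)
  qed
  have int: "integrable (measure_pmf ?M) (\<lambda>\<omega>. \<Prod>e\<in>A. g (\<omega> e))"
    using assms(1) by (intro integrable_prod_Pi_pmf integrable_measure_pmf_finite) auto
  have "measure_pmf.prob ?M {\<omega>. real (card {e\<in>A. \<not> \<omega> e}) \<le> a} \<le>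
      measure_pmf.prob ?M {\<omega>. exp (- a) \<le> (\<Prod>e\<in>A. g (\<omega> e))}"
    by (intro measure_pmf.finite_measure_mono sub) auto
  also have "\<dots> \<le> measure_pmf.expectation ?M (\<lambda>\<omega>. \<Prod>e\<in>A. g (\<omega> e)) / exp (- a)"
    using integral_Markov_inequality_measure[OF int, of UNIV "exp (- a)"]
    by (auto simp: g)
  also have "\<dots> \<le> exp (- (2 * a)) / exp (- a)"
    by (intro divide_right_mono E) auto
  also have "\<dots> = exp (- a)"
    by (simp add: exp_diff[symmetric])
  finally show ?thesis
    by (simp only: a_def)
qed

text \<open>
  If neither alternative in the assumption of \<open>le_nonnbr_bound\<close> holds for the sizes of \<open>S\<close> and
  \<open>T\<close>, averaging the two inequalities bounds the probability that \<open>S\<close> and \<open>T\<close> are non-adjacent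
  by a product of a function of \<open>S\<close> and a function of \<open>T\<close>.
\<close>

lemma prob_nonadjacent_le:
  assumes "n \<ge> 1" "0 < p" "p \<le> 1"
  shows "measure_pmf.prob (Pi_pmf (pairs {..<n}) False (\<lambda>_. bernoulli_pmf p))
      {\<omega>. \<exists>S T. S \<subseteq> {..<n} \<and> T \<subseteq> {..<n} \<and> S \<inter> T = {} \<and> S \<noteq> {} \<and>
        (\<forall>s\<in>S. \<forall>t\<in>T. \<not> \<omega> {s, t}) \<and> nonnbr_bound n p (card S) < real (card T)}
    \<le> (1 / real n)\<^sup>2"
proof -
  let ?M = "Pi_pmf (pairs {..<n}) False (\<lambda>_. bernoulli_pmf p)"
  let ?P = "Pow {..<n} - {{}}"
  define L where "L i = 1 + ln (real n / real i)" for i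
  \<comment> \<open>Irrelevant pairs get the empty event, so the union bound can run over a full
    product of index sets and its sum factorises.\<close>
  define B :: "nat set \<times> nat set \<Rightarrow> (nat set \<Rightarrow> bool) set" where "B = (\<lambda>(S, T). if S \<inter> T = {} \<and> nonnbr_bound n p (card S) < real (card T)
    then {\<omega>. \<forall>s\<in>S. \<forall>t\<in>T. \<not> \<omega> {s, t}} else {})"
  define h where "h S = exp (- 3 * (real (card S) * L (card S)))" for S :: "nat set"
  have card: "1 \<le> card S" "card S \<le> n" if "S \<in> ?P" for S
    using that card_mono[of "{..<n}" S] finite_subset[of S "{..<n}"]
    by (auto simp: Suc_le_eq card_gt_0_iff)
  have prob_B: "measure_pmf.prob ?M (B (S, T)) \<le> h S * h T" if S: "S \<in> ?P" and T: "T \<in> ?P" for S T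
  proof (cases "S \<inter> T = {} \<and> nonnbr_bound n p (card S) < real (card T)")
    case True
    let ?F = "(\<lambda>(s, t). {s, t}) ` (S \<times> T)"
    \<comment> \<open>Disjointness of \<open>S\<close> and \<open>T\<close> ensures that no edge
      arises from two different pairs.\<close>
    have "inj_on (\<lambda>(s, t). {s, t}) (S \<times> T)"
      using True by (auto simp: inj_on_def doubleton_eq_iff)
    then have card_F: "card ?F = card S * card T"
      by (simp add: card_image card_cartesian_product)
    have F: "?F \<subseteq> pairs {..<n}"
      using True S T by (auto simp: doubleton_in_pairs)
    have "B (S, T) = {\<omega>. \<forall>e\<in>?F. \<not> \<omega> e}"
      using True by (auto simp: B_def)
    then have "measure_pmf.prob ?M (B (S, T)) \<le> exp (- (p * real (card S * card T)))"
      using prob_Pi_bernoulli_all_False_le[OF finite_pairs[of "{..<n}"] F, of p False] assms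
      unfolding card_F by simp
    also have "\<dots> \<le> exp (- 3 * (real (card S) * L (card S)) + - 3 * (real (card T) * L (card T)))"
    proof -
      have "6 * L (card S) \<le> p * real (card T)" "6 * L (card T) \<le> p * real (card S)"
        using True le_nonnbr_bound[OF assms(2) card[OF S] card[OF T]] unfolding L_def by linarith+
      then have "real (card S) * (6 * L (card S)) \<le> real (card S) * (p * real (card T))"
        "real (card T) * (6 * L (card T)) \<le> real (card T) * (p * real (card S))"
        by (intro mult_left_mono; simp)+
      then show ?thesis
        by (simp add: algebra_simps)
    qed
    finally show ?thesis
      by (simp only: h_def exp_add)
  qed (auto simp: B_def h_def)
  have "{\<omega>. \<exists>S T. S \<subseteq> {..<n} \<and> T \<subseteq> {..<n} \<and> S \<inter> T = {} \<and> S \<noteq> {} \<and>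
        (\<forall>s\<in>S. \<forall>t\<in>T. \<not> \<omega> {s, t}) \<and> nonnbr_bound n p (card S) < real (card T)}
      \<subseteq> (\<Union>x\<in>?P \<times> ?P. B x)"
  proof clarify
    fix \<omega> :: "nat set \<Rightarrow> bool" and S T
    assume *: "S \<subseteq> {..<n}" "T \<subseteq> {..<n}" "S \<inter> T = {}" "S \<noteq> {}"
      "\<forall>s\<in>S. \<forall>t\<in>T. \<not> \<omega> {s, t}" "nonnbr_bound n p (card S) < real (card T)"
    have "1 \<le> card S" "card S \<le> n" using card[of S] *(1,4) by auto
    \<comment> \<open>Nonnegativity forces \<open>T\<close> to be nonempty, as membership in
      \<open>?P\<close> requires.\<close>
    then have "0 \<le> nonnbr_bound n p (card S)"
      unfolding nonnbr_bound_def using assms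
      by (intro add_nonneg_nonneg mult_nonneg_nonneg ln_ge_zero) auto
    with *(6) have "T \<noteq> {}" by auto
    with * show "\<omega> \<in> (\<Union>x\<in>?P \<times> ?P. B x)"
      by (intro UN_I[of "(S, T)"]) (auto simp: B_def)
  qed
  then have "measure_pmf.prob ?M {\<omega>. \<exists>S T. S \<subseteq> {..<n} \<and> T \<subseteq> {..<n} \<and> S \<inter> T = {} \<and> S \<noteq> {} \<and>
        (\<forall>s\<in>S. \<forall>t\<in>T. \<not> \<omega> {s, t}) \<and> nonnbr_bound n p (card S) < real (card T)}
      \<le> measure_pmf.prob ?M (\<Union>x\<in>?P \<times> ?P. B x)"
    by (intro measure_pmf.finite_measure_mono) auto
  also have "\<dots> \<le> (\<Sum>x\<in>?P \<times> ?P. measure_pmf.prob ?M (B x))"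
    by (intro measure_pmf.finite_measure_subadditive_finite) auto
  also have "\<dots> \<le> (\<Sum>x\<in>?P \<times> ?P. h (fst x) * h (snd x))"
    using prob_B by (intro sum_mono) (simp only: split_paired_all mem_Times_iff fst_conv snd_conv)
  also have "\<dots> = (\<Sum>S\<in>?P. h S)\<^sup>2"
    by (simp add: power2_eq_square sum_product sum.cartesian_product case_prod_unfold)
  also have "\<dots> \<le> (1 / real n)\<^sup>2"
  proof (rule power_mono)
    show "(\<Sum>S\<in>?P. h S) \<le> 1 / real n"
      unfolding h_def L_def by (rule sum_exp_neg_ln_ratio_le[OF assms(1)])
    show "0 \<le> (\<Sum>S\<in>?P. h S)"
      by (intro sum_nonneg) (simp add: h_def)
  qed
  finally show ?thesis .
qed

section \<open>The boxicity of the random graph\<close>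

lemma card_pairs:
  assumes "finite V"
  shows "card (pairs V) = card V choose 2"
  unfolding pairs_def using assms by (rule n_subsets)

text \<open>The constant is \<open>480 = 4 * 4 * 30\<close>: there are at least
  \<open>n^2 / 4\<close> pairs, at least a quarter of the expected number of non-edges occurs, and
  one interval graph omits at most \<open>30 * n / p\<close> pairs. The two error terms are the
  failure probabilities of the non-adjacency bound and of the non-edge count.\<close>

lemma prob_boxicity_ge:
  assumes n: "n \<ge> 2" and p: "0 < p" "p \<le> 1"
  shows "measure_pmf.prob (random_graph n p)
      {E. real (boxicity {..<n} E) \<ge> 1 / 480 * (real n * p * (1 - p))}
    \<ge> 1 - (1 / real n)\<^sup>2 - exp (- ((real n)\<^sup>2 * (1 - p) / 16))"
proof -
  let ?M = "Pi_pmf (pairs {..<n}) False (\<lambda>_. bernoulli_pmf p)"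
  let ?G = "\<lambda>\<omega>. {e \<in> pairs {..<n}. \<omega> e}"
  let ?N = "real (card (pairs {..<n}))"
  define X where "X = {\<omega>. \<exists>S T. S \<subseteq> {..<n} \<and> T \<subseteq> {..<n} \<and> S \<inter> T = {} \<and> S \<noteq> {} \<and>
        (\<forall>s\<in>S. \<forall>t\<in>T. \<not> \<omega> {s, t}) \<and> nonnbr_bound n p (card S) < real (card T)}"
  define Y where "Y = {\<omega>. real (card {e\<in>pairs {..<n}. \<not> \<omega> e}) \<le> ?N * (1 - p) / 4}"
  define Z where "Z = {\<omega>. real (boxicity {..<n} (?G \<omega>)) \<ge> 1 / 480 * (real n * p * (1 - p))}"
  have "2 * ?N = real n * (real n - 1)"
  proof -
    have "2 * card (pairs {..<n}) = n * (n - 1)"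
      by (auto simp: card_pairs choose_two intro!: dvd_mult_div_cancel)
    then have "real (2 * card (pairs {..<n})) = real (n * (n - 1))" by (rule arg_cong)
    then show ?thesis using n by (simp add: of_nat_diff)
  qed
  moreover have "real n * (real n - 1) \<ge> real n * (real n / 2)"
    using n by (intro mult_left_mono) auto
  ultimately have N: "?N \<ge> (real n)\<^sup>2 / 4"
    by (simp add: power2_eq_square)
  \<comment> \<open>Outside the bad events \<open>X\<close> and \<open>Y\<close> the boxicity bound
    is deterministic.\<close>
  have "\<omega> \<in> X \<union> Y \<union> Z" for \<omega>
  proof (cases "\<omega> \<in> X \<union> Y")
    case False
    have nonedges: "pairs {..<n} - ?G \<omega> = {e\<in>pairs {..<n}. \<not> \<omega> e}"
      by auto
    have "(real n)\<^sup>2 / 4 * ((1 - p) / 4) \<le> ?N * ((1 - p) / 4)"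
      using p by (intro mult_right_mono N) auto
    also have "\<dots> \<le> real (card (pairs {..<n} - ?G \<omega>))"
      using False unfolding nonedges Y_def by simp
    also have "\<dots> \<le> real (boxicity {..<n} (?G \<omega>)) * (\<Sum>i=1..card {..<n}. nonnbr_bound n p i)"
    proof (rule card_nonedges_le_boxicity_mult)
      fix i j :: nat
      assume "1 \<le> i" "i \<le> j" "j \<le> card {..<n}"
      then show "nonnbr_bound n p j \<le> nonnbr_bound n p i"
        using p by (intro nonnbr_bound_antimono) auto
    next
      fix S T
      assume *: "S \<subseteq> {..<n}" "T \<subseteq> {..<n}" "S \<inter> T = {}" "S \<noteq> {}"
        "\<forall>s\<in>S. \<forall>t\<in>T. {s, t} \<notin> ?G \<omega>"
      then have nonadj: "\<forall>s\<in>S. \<forall>t\<in>T. \<not> \<omega> {s, t}"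
        by (fastforce simp: doubleton_in_pairs)
      show "real (card T) \<le> nonnbr_bound n p (card S)"
      proof (rule ccontr)
        assume "\<not> real (card T) \<le> nonnbr_bound n p (card S)"
        with *(1-4) nonadj have "\<omega> \<in> X"
          unfolding X_def by (intro CollectI exI[of _ S] exI[of _ T]) simp
        with False show False by simp
      qed
    qed auto
    also have "\<dots> \<le> real (boxicity {..<n} (?G \<omega>)) * (30 * real n / p)"
      using sum_nonnbr_bound_le[OF p(1), of n] by (intro mult_left_mono) auto
    finally have "real n * (real n * p * (1 - p)) \<le> real n * (480 * real (boxicity {..<n} (?G \<omega>)))"
      using p n by (simp add: field_simps power2_eq_square)
    then have "real n * p * (1 - p) \<le> 480 * real (boxicity {..<n} (?G \<omega>))"
      using n by (subst (asm) mult_le_cancel_left_pos) auto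
    then show ?thesis
      by (simp add: Z_def)
  qed auto
  then have "measure_pmf.prob ?M UNIV \<le> measure_pmf.prob ?M (X \<union> Y \<union> Z)"
    by (intro measure_pmf.finite_measure_mono) auto
  also have "\<dots> \<le> measure_pmf.prob ?M (X \<union> Y) + measure_pmf.prob ?M Z"
    by (intro measure_Un_le) auto
  also have "measure_pmf.prob ?M (X \<union> Y) \<le> measure_pmf.prob ?M X + measure_pmf.prob ?M Y"
    by (intro measure_Un_le) auto
  also have "measure_pmf.prob ?M X \<le> (1 / real n)\<^sup>2"
    unfolding X_def using n p by (intro prob_nonadjacent_le) auto
  also have "measure_pmf.prob ?M Y \<le> exp (- (?N * (1 - p) / 4))"
    unfolding Y_def using p by (intro prob_few_False_le finite_pairs) auto
  also have "\<dots> \<le> exp (- ((real n)\<^sup>2 * (1 - p) / 16))"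
    using mult_right_mono[OF N, of "1 - p"] p by (simp add: mult_ac)
  finally have "1 - (1 / real n)\<^sup>2 - exp (- ((real n)\<^sup>2 * (1 - p) / 16)) \<le> measure_pmf.prob ?M Z"
    by simp
  also have "measure_pmf.prob ?M Z = measure_pmf.prob (random_graph n p)
      {E. real (boxicity {..<n} E) \<ge> 1 / 480 * (real n * p * (1 - p))}"
    by (simp add: random_graph_def Z_def vimage_def)
  finally show ?thesis .
qed

theorem theorem5:
  "\<exists>c2::real. c2 > 0 \<and> (\<exists>c::real. c > 0 \<and>
     (\<forall>p :: nat \<Rightarrow> real.
        (\<forall>\<^sub>F n in sequentially.
           exp (exp (exp 1)) / real n \<le> p n \<and>
           p n \<le> 1 - c2 * (ln (real n) / (real n)\<^sup>2)) \<longrightarrow>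
        (\<lambda>n. measure_pmf.prob (random_graph n (p n))
               {E. real (boxicity {..<n} E) \<ge> c * (real n * p n * (1 - p n))})
          \<longlonglongrightarrow> 1))"
proof (rule exI[of _ 1], intro conjI, simp, rule exI[of _ "1 / 480"], intro conjI allI impI)
  fix p :: "nat \<Rightarrow> real"
  assume p: "\<forall>\<^sub>F n in sequentially.
    exp (exp (exp 1)) / real n \<le> p n \<and> p n \<le> 1 - 1 * (ln (real n) / (real n)\<^sup>2)"
  show "(\<lambda>n. measure_pmf.prob (random_graph n (p n))
      {E. real (boxicity {..<n} E) \<ge> 1 / 480 * (real n * p n * (1 - p n))}) \<longlonglongrightarrow> 1"
  proof (rule tendsto_sandwich)
    show "\<forall>\<^sub>F n in sequentially. 1 - (1 / real n)\<^sup>2 - exp (- (ln (real n) / 16)) \<le>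
        measure_pmf.prob (random_graph n (p n))
          {E. real (boxicity {..<n} E) \<ge> 1 / 480 * (real n * p n * (1 - p n))}"
      using p eventually_ge_at_top[of 2]
    proof eventually_elim
      case (elim n)
      \<comment> \<open>The lower bound on \<open>p n\<close> makes it positive; the upper bound
        keeps it at most 1 because \<open>ln n \<ge> 0\<close>.\<close>
      have "0 < exp (exp (exp 1)) / real n" "0 \<le> ln (real n) / (real n)\<^sup>2"
        using elim by auto
      with elim have pn: "0 < p n" "p n \<le> 1" by linarith+
      \<comment> \<open>With the choice 1 for \<open>c2\<close>, the upper bound on
        \<open>p n\<close> says exactly this, so the second error term is at most
        \<open>n powr (- 1 / 16)\<close> and vanishes.\<close>
      have "ln (real n) \<le> (real n)\<^sup>2 * (1 - p n)"
        using elim by (simp add: field_simps)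
      then have "exp (- ((real n)\<^sup>2 * (1 - p n) / 16)) \<le> exp (- (ln (real n) / 16))"
        by simp
      with prob_boxicity_ge[OF elim(2) pn] show ?case by linarith
    qed
    show "(\<lambda>n. 1 - (1 / real n)\<^sup>2 - exp (- (ln (real n) / 16))) \<longlonglongrightarrow> 1"
      by real_asymp
  qed auto
qed auto

end
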